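(* Let $X$ be a graph and $k\ge 0$ an integer. If $X\in D_k$ and $X$ is $(k+1)$-complete-transitive, then $X$ is a complete graph.
   Context: All graphs are finite, undirected, without loops or multiple edges, with at least one vertex. For a graph $X$ and a vertex $x$, $N_X(x)$ is the set of neighbours of $x$, identified with the subgraph of $X$ it induces, and $N_X[x]=N_X(x)\cup\{x\}$. A graph $X$ is a cone if it has a vertex $x$ with $N_X[x]=V(X)$; the one-vertex graph is a cone. Let $D_{-1}$ be the class of cones. Inductively, for an integer $k\ge 0$: a vertex $x$ of $X$ is $k$-dismantlable if $N_X(x)$ is non-empty and the graph $N_X(x)$ belongs to $D_{k-1}$; a graph is $k$-dismantlable if it can be reduced to a single vertex by successively deleting vertices, each being $k$-dismantlable in the current graph; $D_k$ is the class of $k$-dismantlable graphs. For $i\ge 1$, a graph $X$ is $i$-complete-transitive if for all $1\le k\le i$ and all pairs $(x_1,\dots,x_k)$, $(x'_1,\dots,x'_k)$ of $k$-tuples of pairwise distinct vertices, each inducing a complete subgraph of $X$, there exists an automorphism $f$ of $X$ such that $f(x_j)=x'_j$ for all $j\in\{1,\dots,k\}$. *)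

theory Defs
  imports "Graph_Theory.Graph_Theory"
begin

text \<open>
  A finite simple graph is a symmetric, loop-free digraph without parallel arcs
  (locale \<^locale>\<open>graph\<close>), each undirected edge being a pair of opposite arcs.
  That locale admits the graph without vertices.
\<close>

definition neighbours :: "('a,'b) pre_digraph \<Rightarrow> 'a \<Rightarrow> 'a set" where
  "neighbours X x = {y \<in> verts X. x \<rightarrow>\<^bsub>X\<^esub> y}"

definition closed_neighbours :: "('a,'b) pre_digraph \<Rightarrow> 'a \<Rightarrow> 'a set" where
  "closed_neighbours X x = insert x (neighbours X x)"

definition neighbour_graph :: "('a,'b) pre_digraph \<Rightarrow> 'a \<Rightarrow> ('a,'b) pre_digraph" where
  "neighbour_graph X x = X \<restriction> neighbours X x"

definition cone :: "('a,'b) pre_digraph \<Rightarrow> bool" where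
  "cone X \<longleftrightarrow> (\<exists>x \<in> verts X. closed_neighbours X x = verts X)"

definition complete_graph :: "('a,'b) pre_digraph \<Rightarrow> bool" where
  "complete_graph X \<longleftrightarrow> K\<^bsub>card (verts X)\<^esub> X"

inductive reducible_by ::
  "(('a,'b) pre_digraph \<Rightarrow> 'a \<Rightarrow> bool) \<Rightarrow> ('a,'b) pre_digraph \<Rightarrow> bool"
  for P :: "('a,'b) pre_digraph \<Rightarrow> 'a \<Rightarrow> bool" where
  single: "card (verts X) = 1 \<Longrightarrow> reducible_by P X"
| delete: "x \<in> verts X \<Longrightarrow> P X x \<Longrightarrow> reducible_by P (pre_digraph.del_vert X x) \<Longrightarrow> reducible_by P X"

text \<open>
  The class $D_{-1}$ is \<^const>\<open>cone\<close>; for $k \ge 0$, $D_k$ is \<open>dismantlable k\<close>, which the second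
  clause of the recursion has to spell out.
\<close>

primrec dismantlable_vertex :: "nat \<Rightarrow> ('a,'b) pre_digraph \<Rightarrow> 'a \<Rightarrow> bool" where
  "dismantlable_vertex 0 X x \<longleftrightarrow>
     neighbours X x \<noteq> {} \<and> cone (neighbour_graph X x)"
| "dismantlable_vertex (Suc k) X x \<longleftrightarrow>
     neighbours X x \<noteq> {} \<and> reducible_by (dismantlable_vertex k) (neighbour_graph X x)"

definition dismantlable :: "nat \<Rightarrow> ('a,'b) pre_digraph \<Rightarrow> bool" where
  "dismantlable k X \<longleftrightarrow> reducible_by (dismantlable_vertex k) X"

text \<open>
  The vertex maps of the isomorphisms from \<open>X\<close> to itself; the values outside \<^term>\<open>verts X\<close>
  are arbitrary.
\<close>

definition automorphism :: "('a,'b) pre_digraph \<Rightarrow> ('a \<Rightarrow> 'a) \<Rightarrow> bool" where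
  "automorphism X f \<longleftrightarrow>
     (\<exists>h. pre_digraph.digraph_isomorphism X h \<and> app_iso h X = X \<and> iso_verts h = f)"

definition complete_tuple :: "('a,'b) pre_digraph \<Rightarrow> nat \<Rightarrow> 'a list \<Rightarrow> bool" where
  "complete_tuple X k xs \<longleftrightarrow>
     length xs = k \<and> distinct xs \<and> set xs \<subseteq> verts X \<and> complete_graph (X \<restriction> set xs)"

definition complete_transitive :: "nat \<Rightarrow> ('a,'b) pre_digraph \<Rightarrow> bool" where
  "complete_transitive i X \<longleftrightarrow>
     (\<forall>k xs xs'. 1 \<le> k \<and> k \<le> i \<and> complete_tuple X k xs \<and> complete_tuple X k xs' \<longrightarrow>
        (\<exists>f. automorphism X f \<and> (\<forall>j<k. f (xs ! j) = xs' ! j)))"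

end

theory Submission
  imports Defs
begin

text \<open>
  The proof is by induction on \<open>k\<close>. Let \<open>X\<close> have more than one vertex, so that a \<open>k\<close>-dismantlable
  vertex \<open>x\<close> exists.

  For \<open>k > 0\<close> the graph \<open>N(x)\<close> is \<open>(k-1)\<close>-dismantlable, and it is \<open>k\<close>-complete-transitive, because
  an automorphism of \<open>X\<close> that carries \<open>(x, x\<^sub>1, \<dots>, x\<^sub>j)\<close> to \<open>(x, x'\<^sub>1, \<dots>, x'\<^sub>j)\<close> fixes \<open>x\<close> and so
  restricts to \<open>N(x)\<close> (\<open>complete_transitive_neighbour_graph\<close>). By the induction hypothesis \<open>N(x)\<close> is
  complete, and since \<open>X\<close> is vertex-transitive all neighbourhoods are complete: \<open>X\<close> is a disjoint
  union of complete graphs, and it remains one under deletions. A dismantlable vertex has a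
  neighbour, and in such a graph the two are twins, that is, \<open>N[x] = N[y]\<close>.

  For \<open>k = 0\<close> the neighbourhood of \<open>x\<close> is a cone, that is, \<open>N[x] \<subseteq> N[y]\<close> for some neighbour \<open>y\<close>.
  Vertex-transitivity makes \<open>X\<close> regular, so no closed neighbourhood lies strictly inside another and
  \<open>x\<close>, \<open>y\<close> are twins. Deleting \<open>x\<close> destroys transitivity in general, but it
  does preserve the absence of strict inclusions between closed neighbourhoods, since the
  remaining twin \<open>y\<close> records adjacency to \<open>x\<close> (\<open>nested_neighbours_equal_del_vert\<close>). Hence every
  deletion in the sequence removes a twin.

  Both cases end in the same way: a graph that shrinks to one vertex by deletions of twins is
  complete (\<open>complete_graph_if_twin_deletions\<close>).
\<close>

section \<open>Adjacency in induced subgraphs\<close>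

lemma (in graph) graph_induce_subgraph:
  assumes "S \<subseteq> verts G"
  shows "graph (G \<restriction> S)"
proof -
  have "induced_subgraph (G \<restriction> S) G" using assms by (rule induced_induce)
  then interpret H: digraph "G \<restriction> S" by (rule digraphI_induced)
  have "sym_digraph (G \<restriction> S)"
    using \<open>induced_subgraph (G \<restriction> S) G\<close> by (rule induced_graph_imp_graph)
  then interpret S: sym_digraph "G \<restriction> S" .
  show ?thesis by unfold_locales
qed

lemma dominates_induce_subgraph_iff:
  "u \<rightarrow>\<^bsub>X \<restriction> S\<^esub> v \<longleftrightarrow> u \<rightarrow>\<^bsub>X\<^esub> v \<and> u \<in> S \<and> v \<in> S"
  by (auto simp: arcs_ends_conv)

lemma (in wf_digraph) del_vert_eq_induce_subgraph: "del_vert x = G \<restriction> (verts G - {x})"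
  by (auto simp: del_vert_def induce_subgraph_def)

lemma (in graph) graph_del_vert: "graph (del_vert x)"
  by (simp add: del_vert_eq_induce_subgraph graph_induce_subgraph)

lemma (in graph) graph_neighbour_graph: "graph (neighbour_graph G x)"
  unfolding neighbour_graph_def by (rule graph_induce_subgraph) (auto simp: neighbours_def)

lemma (in graph) dominates_sym: "u \<rightarrow>\<^bsub>G\<^esub> v \<Longrightarrow> v \<rightarrow>\<^bsub>G\<^esub> u"
  using sym_arcs by (auto simp: symmetric_def dest: symD)

lemma (in graph) dominates_commute: "u \<rightarrow>\<^bsub>G\<^esub> v \<longleftrightarrow> v \<rightarrow>\<^bsub>G\<^esub> u"
  using dominates_sym by blast

lemma (in wf_digraph) in_neighbours_iff: "y \<in> neighbours G x \<longleftrightarrow> x \<rightarrow>\<^bsub>G\<^esub> y"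
  by (auto simp: neighbours_def dest: adj_in_verts)

lemma (in wf_digraph) in_closed_neighbours_iff:
  "y \<in> closed_neighbours G x \<longleftrightarrow> y = x \<or> x \<rightarrow>\<^bsub>G\<^esub> y"
  by (simp add: closed_neighbours_def in_neighbours_iff)

lemma (in graph) in_closed_neighbours_commute:
  "y \<in> closed_neighbours G x \<longleftrightarrow> x \<in> closed_neighbours G y"
  by (auto simp: in_closed_neighbours_iff dominates_commute)

lemma (in wf_digraph) closed_neighbours_subset_verts:
  "x \<in> verts G \<Longrightarrow> closed_neighbours G x \<subseteq> verts G"
  by (auto simp: closed_neighbours_def neighbours_def)

lemma (in graph) closed_neighbours_del_vert:
  assumes "a \<noteq> x"
  shows "closed_neighbours (del_vert x) a = closed_neighbours G a - {x}"
  using assms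
  by (auto simp: closed_neighbours_def neighbours_def del_vert_eq_induce_subgraph
      dominates_induce_subgraph_iff dest: adj_in_verts)

lemma (in graph) complete_graph_iff:
  "complete_graph G \<longleftrightarrow> (\<forall>u \<in> verts G. \<forall>v \<in> verts G. u \<noteq> v \<longrightarrow> u \<rightarrow>\<^bsub>G\<^esub> v)"
  using graph_axioms
  by (auto simp: complete_graph_def complete_digraph_def dest: adj_in_verts adj_not_same)

lemma (in graph) complete_graph_iff_closed_neighbours:
  "complete_graph G \<longleftrightarrow> (\<forall>u \<in> verts G. closed_neighbours G u = verts G)"
proof -
  have "closed_neighbours G u = verts G \<longleftrightarrow> (\<forall>v \<in> verts G. u \<noteq> v \<longrightarrow> u \<rightarrow>\<^bsub>G\<^esub> v)"
    if "u \<in> verts G" for u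
    using closed_neighbours_subset_verts[OF that] by (auto simp: in_closed_neighbours_iff)
  then show ?thesis by (simp add: complete_graph_iff)
qed

lemma (in graph) complete_graph_neighbour_graph_iff:
  "complete_graph (neighbour_graph G x) \<longleftrightarrow>
     (\<forall>a b. x \<rightarrow>\<^bsub>G\<^esub> a \<and> x \<rightarrow>\<^bsub>G\<^esub> b \<and> a \<noteq> b \<longrightarrow> a \<rightarrow>\<^bsub>G\<^esub> b)"
  unfolding graph.complete_graph_iff[OF graph_neighbour_graph]
  unfolding neighbour_graph_def induce_subgraph_verts dominates_induce_subgraph_iff
    Ball_def in_neighbours_iff
  by blast

lemma (in graph) complete_tuple_iff:
  "complete_tuple G k xs \<longleftrightarrow> length xs = k \<and> distinct xs \<and> set xs \<subseteq> verts G \<and>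
     (\<forall>u \<in> set xs. \<forall>v \<in> set xs. u \<noteq> v \<longrightarrow> u \<rightarrow>\<^bsub>G\<^esub> v)"
  by (auto simp: complete_tuple_def graph.complete_graph_iff[OF graph_induce_subgraph]
      dominates_induce_subgraph_iff)

section \<open>Automorphisms and transitivity\<close>

lemma automorphism_inj_on: "automorphism X f \<Longrightarrow> inj_on f (verts X)"
  by (auto simp: automorphism_def pre_digraph.digraph_isomorphism_def)

lemma (in wf_digraph) arcs_ends_automorphism:
  assumes "automorphism G f"
  shows "arcs_ends G = (\<lambda>(u, v). (f u, f v)) ` arcs_ends G"
proof -
  obtain h where h: "digraph_isomorphism h" "app_iso h G = G" "iso_verts h = f"
    using assms by (auto simp: automorphism_def)
  show ?thesis using arcs_ends_app_iso_eq[OF h(1)] by (simp add: h)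
qed

lemma (in wf_digraph) automorphism_neighbours:
  assumes f: "automorphism G f" and x: "x \<in> verts G"
  shows "f ` neighbours G x = neighbours G (f x)"
proof (intro equalityI subsetI)
  fix y assume "y \<in> f ` neighbours G x"
  then obtain z where "x \<rightarrow>\<^bsub>G\<^esub> z" "y = f z" by (auto simp: in_neighbours_iff)
  then show "y \<in> neighbours G (f x)"
    unfolding in_neighbours_iff by (subst arcs_ends_automorphism[OF f]) force
next
  fix y assume "y \<in> neighbours G (f x)"
  then have "(f x, y) \<in> (\<lambda>(u, v). (f u, f v)) ` arcs_ends G"
    using arcs_ends_automorphism[OF f] by (simp add: in_neighbours_iff)
  then obtain u v where uv: "u \<rightarrow>\<^bsub>G\<^esub> v" "f x = f u" "y = f v" by auto
  then have "u = x"
    using x automorphism_inj_on[OF f] by (auto dest: inj_onD adj_in_verts)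
  with uv show "y \<in> f ` neighbours G x" by (auto simp: in_neighbours_iff)
qed

lemma (in graph) automorphism_induce_subgraph:
  assumes f: "automorphism G f" and S: "S \<subseteq> verts G" "f ` S = S"
  shows "automorphism (G \<restriction> S) f"
proof -
  obtain h where h: "digraph_isomorphism h" "app_iso h G = G" "iso_verts h = f"
    using f by (auto simp: automorphism_def)
  have ends: "iso_tail h = tail G" "iso_head h = head G" "iso_arcs h ` arcs G = arcs G"
    using h(2) by (metis tail_app_iso, metis head_app_iso, metis arcs_app_iso)
  have iso: "tail G (iso_arcs h e) = f (tail G e)" "head G (iso_arcs h e) = f (head G e)"
    if "e \<in> arcs G" for e
    using iso_verts_tail[OF h(1) that] iso_verts_head[OF h(1) that] h(3) ends by simp_all
  have mem: "f v \<in> S \<longleftrightarrow> v \<in> S" if "v \<in> verts G" for v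
    using inj_on_image_mem_iff[OF automorphism_inj_on[OF f] that S(1)] S(2) by simp
  have "iso_arcs h ` arcs (G \<restriction> S) = arcs (G \<restriction> S)"
  proof (intro equalityI subsetI)
    fix e assume "e \<in> iso_arcs h ` arcs (G \<restriction> S)"
    then show "e \<in> arcs (G \<restriction> S)" using ends(3) by (auto simp: iso mem)
  next
    fix e assume e: "e \<in> arcs (G \<restriction> S)"
    then obtain d where "d \<in> arcs G" "e = iso_arcs h d" using ends(3) by auto
    with e show "e \<in> iso_arcs h ` arcs (G \<restriction> S)" by (auto simp: iso mem)
  qed
  then have "app_iso h (G \<restriction> S) = G \<restriction> S"
    using S(2) h(3) ends by (intro pre_digraph.equality) simp_all
  moreover have "pre_digraph.digraph_isomorphism (G \<restriction> S) h"
    using digraph_isomorphism_subgraphI[OF h(1) subgraph_induce_subgraphI[OF S(1)]] .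
  ultimately show ?thesis using h(3) by (auto simp: automorphism_def)
qed

lemma (in graph) vertex_transitive:
  assumes "complete_transitive i G" "1 \<le> i" "x \<in> verts G" "y \<in> verts G"
  obtains f where "automorphism G f" "f x = y"
proof -
  have "complete_tuple G 1 [x]" "complete_tuple G 1 [y]"
    using assms by (auto simp: complete_tuple_iff)
  then have "\<exists>f. automorphism G f \<and> (\<forall>j<1. f ([x] ! j) = [y] ! j)"
    using assms(1,2) unfolding complete_transitive_def by blast
  then show thesis using that by auto
qed

text \<open>
  Prefixing \<open>x\<close> to a complete tuple of neighbours of \<open>x\<close> gives a complete tuple one longer, which is
  why one degree of transitivity is lost.
\<close>
lemma (in graph) complete_transitive_neighbour_graph:
  assumes trans: "complete_transitive (Suc i) G" and x: "x \<in> verts G"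
  shows "complete_transitive i (neighbour_graph G x)"
  unfolding complete_transitive_def
proof (intro allI impI, elim conjE)
  fix k xs xs'
  assume k: "1 \<le> k" "k \<le> i"
    and xs: "complete_tuple (neighbour_graph G x) k xs"
    and xs': "complete_tuple (neighbour_graph G x) k xs'"
  have cons: "complete_tuple G (Suc k) (x # ys)"
    if "complete_tuple (neighbour_graph G x) k ys" for ys
  proof -
    have "length ys = k \<and> distinct ys \<and> (\<forall>u \<in> set ys. x \<rightarrow>\<^bsub>G\<^esub> u) \<and>
        (\<forall>u \<in> set ys. \<forall>v \<in> set ys. u \<noteq> v \<longrightarrow> u \<rightarrow>\<^bsub>G\<^esub> v)"
      using that unfolding graph.complete_tuple_iff[OF graph_neighbour_graph]
      by (auto simp: neighbour_graph_def dominates_induce_subgraph_iff in_neighbours_iff)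
    then show ?thesis
      using x unfolding complete_tuple_iff
      by (auto simp: dominates_commute dest: adj_in_verts adj_not_same)
  qed
  have "\<exists>f. automorphism G f \<and> (\<forall>j<Suc k. f ((x # xs) ! j) = (x # xs') ! j)"
    using trans k cons[OF xs] cons[OF xs'] unfolding complete_transitive_def
    by (metis Suc_le_mono le_SucI)
  then obtain f where f: "automorphism G f"
    and map: "\<And>j. j < Suc k \<Longrightarrow> f ((x # xs) ! j) = (x # xs') ! j" by blast
  have "f x = x" using map[of 0] by simp
  then have "f ` neighbours G x = neighbours G x" using automorphism_neighbours[OF f x] by simp
  then have "automorphism (neighbour_graph G x) f"
    unfolding neighbour_graph_def
    by (intro automorphism_induce_subgraph f) (auto simp: neighbours_def)
  moreover have "f (xs ! j) = xs' ! j" if "j < k" for j using map[of "Suc j"] that by simp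
  ultimately show "\<exists>f. automorphism (neighbour_graph G x) f \<and> (\<forall>j<k. f (xs ! j) = xs' ! j)"
    by blast
qed

section \<open>Deleting twins\<close>

text \<open>
  Read backwards, the deletions add to a complete graph a vertex \<open>x\<close> with \<open>N[x] = N[y]\<close>. Since \<open>y\<close>
  is adjacent to all other vertices, so is \<open>x\<close>. The invariant \<open>I\<close> carries whatever guarantees
  that the deletable vertices are twins.
\<close>
lemma complete_graph_if_twin_deletions:
  assumes "reducible_by P X" "graph X" "I X"
    and twin: "\<And>Y x. graph Y \<Longrightarrow> I Y \<Longrightarrow> P Y x \<Longrightarrow>
      \<exists>y. x \<rightarrow>\<^bsub>Y\<^esub> y \<and> closed_neighbours Y x = closed_neighbours Y y"
    and inherit: "\<And>Y x. graph Y \<Longrightarrow> I Y \<Longrightarrow> P Y x \<Longrightarrow> I (pre_digraph.del_vert Y x)"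
  shows "complete_graph X"
  using assms(1-3)
proof (induction rule: reducible_by.induct)
  case (single X)
  then interpret graph X by simp
  from single(1) show ?case by (auto simp: complete_graph_iff card_1_singleton_iff)
next
  case (delete x X)
  then interpret graph X by simp
  interpret D: graph "del_vert x" by (rule graph_del_vert)
  obtain y where y: "x \<rightarrow>\<^bsub>X\<^esub> y" "closed_neighbours X x = closed_neighbours X y"
    using twin delete by blast
  then have "y \<noteq> x" "y \<in> verts X" by (auto dest: adj_not_same adj_in_verts)
  have "complete_graph (del_vert x)" using delete inherit D.graph_axioms by blast
  then have rest: "closed_neighbours X u - {x} = verts X - {x}" if "u \<in> verts X" "u \<noteq> x" for u
    using that closed_neighbours_del_vert
    by (simp add: D.complete_graph_iff_closed_neighbours verts_del_vert)
  have "closed_neighbours X x - {x} = verts X - {x}"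
    using rest[OF \<open>y \<in> verts X\<close> \<open>y \<noteq> x\<close>] y(2) by simp
  then have x: "closed_neighbours X x = verts X"
    using \<open>x \<in> verts X\<close> by (auto simp: closed_neighbours_def)
  have "closed_neighbours X u = verts X" if "u \<in> verts X" for u
  proof (cases "u = x")
    case False
    have "x \<in> closed_neighbours X u" using x that in_closed_neighbours_commute by blast
    then show ?thesis using rest[OF that False] \<open>x \<in> verts X\<close> by blast
  qed (simp add: x)
  then show ?case by (simp add: complete_graph_iff_closed_neighbours)
qed

section \<open>Regular graphs reduced by deletions of dominated vertices\<close>

definition nested_neighbours_equal :: "('a,'b) pre_digraph \<Rightarrow> bool" where
  "nested_neighbours_equal X \<longleftrightarrow> (\<forall>a \<in> verts X. \<forall>b \<in> verts X.
     closed_neighbours X a \<subseteq> closed_neighbours X b \<longrightarrow> closed_neighbours X a = closed_neighbours X b)"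

text \<open>
  Automorphisms give all closed neighbourhoods the same finite size, and a subset of full size is
  everything.
\<close>
lemma (in graph) nested_neighbours_equal_if_vertex_transitive:
  assumes "complete_transitive i G" "1 \<le> i"
  shows "nested_neighbours_equal G"
  unfolding nested_neighbours_equal_def
proof (intro ballI impI)
  fix a b
  assume ab: "a \<in> verts G" "b \<in> verts G" and sub: "closed_neighbours G a \<subseteq> closed_neighbours G b"
  obtain f where f: "automorphism G f" "f a = b" using vertex_transitive[OF assms ab] .
  have "closed_neighbours G b = f ` closed_neighbours G a"
    using automorphism_neighbours[OF f(1) ab(1)] f(2) by (simp add: closed_neighbours_def)
  moreover have "inj_on f (closed_neighbours G a)"
    using automorphism_inj_on[OF f(1)] closed_neighbours_subset_verts[OF ab(1)]
    by (rule inj_on_subset)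
  ultimately have "card (closed_neighbours G a) = card (closed_neighbours G b)"
    by (simp add: card_image)
  moreover have "finite (closed_neighbours G b)"
    using closed_neighbours_subset_verts[OF ab(2)] finite_verts by (rule finite_subset)
  ultimately show "closed_neighbours G a = closed_neighbours G b"
    using sub by (simp add: card_subset_eq)
qed

text \<open>The apex of the cone \<open>N(x)\<close> is the vertex that dominates \<open>x\<close>.\<close>
lemma (in graph) dismantlable_vertex_0_dominated:
  assumes "dismantlable_vertex 0 G x"
  obtains y where "x \<rightarrow>\<^bsub>G\<^esub> y" "closed_neighbours G x \<subseteq> closed_neighbours G y"
proof -
  obtain y where y: "y \<in> neighbours G x"
    "closed_neighbours (neighbour_graph G x) y = neighbours G x"
    using assms by (auto simp: cone_def neighbour_graph_def)
  have "z \<in> closed_neighbours G y" if "z \<in> neighbours G x" for z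
    using that y(2)
    by (auto simp: closed_neighbours_def neighbours_def neighbour_graph_def
        dominates_induce_subgraph_iff)
  moreover have "x \<in> closed_neighbours G y"
    using y(1) by (simp add: in_neighbours_iff in_closed_neighbours_iff dominates_commute)
  ultimately have "closed_neighbours G x \<subseteq> closed_neighbours G y"
    by (auto simp: closed_neighbours_def[of G x])
  with y(1) show thesis using that by (simp add: in_neighbours_iff)
qed

lemma (in graph) dismantlable_vertex_0_twin:
  assumes "nested_neighbours_equal G" "dismantlable_vertex 0 G x"
  obtains y where "x \<rightarrow>\<^bsub>G\<^esub> y" "closed_neighbours G x = closed_neighbours G y"
proof -
  obtain y where y: "x \<rightarrow>\<^bsub>G\<^esub> y" "closed_neighbours G x \<subseteq> closed_neighbours G y"
    using dismantlable_vertex_0_dominated[OF assms(2)] .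
  then have "x \<in> verts G" "y \<in> verts G" by (auto dest: adj_in_verts)
  with y assms(1) show thesis using that unfolding nested_neighbours_equal_def by blast
qed

text \<open>
  An inclusion between neighbourhoods in the smaller graph lifts to the larger one: if \<open>a\<close> is
  adjacent to \<open>x\<close>, then \<open>a\<close> is in \<open>N[y]\<close>, hence so is \<open>b\<close>, and \<open>b\<close> is adjacent to \<open>x\<close> as well.
\<close>
lemma (in graph) nested_neighbours_equal_del_vert:
  assumes nested: "nested_neighbours_equal G"
    and twin: "x \<rightarrow>\<^bsub>G\<^esub> y" "closed_neighbours G x = closed_neighbours G y"
  shows "nested_neighbours_equal (del_vert x)"
  unfolding nested_neighbours_equal_def
proof (intro ballI impI)
  fix a b
  assume "a \<in> verts (del_vert x)" "b \<in> verts (del_vert x)"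
    and sub: "closed_neighbours (del_vert x) a \<subseteq> closed_neighbours (del_vert x) b"
  then have ab: "a \<in> verts G" "b \<in> verts G" "a \<noteq> x" "b \<noteq> x" by (simp_all add: verts_del_vert)
  have "y \<noteq> x" using twin(1) by (auto dest: adj_not_same)
  have sub': "closed_neighbours G a - {x} \<subseteq> closed_neighbours G b - {x}"
    using sub ab by (simp add: closed_neighbours_del_vert)
  have xy: "x \<in> closed_neighbours G c \<longleftrightarrow> y \<in> closed_neighbours G c" for c
    using twin(2) in_closed_neighbours_commute by blast
  have "closed_neighbours G a \<subseteq> closed_neighbours G b"
    using sub' xy \<open>y \<noteq> x\<close> by blast
  then have "closed_neighbours G a = closed_neighbours G b"
    using nested ab by (simp add: nested_neighbours_equal_def)
  then show "closed_neighbours (del_vert x) a = closed_neighbours (del_vert x) b"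
    using ab by (simp add: closed_neighbours_del_vert)
qed

lemma (in graph) complete_graph_if_dismantlable_0:
  assumes "reducible_by (dismantlable_vertex 0) G" "nested_neighbours_equal G"
  shows "complete_graph G"
  using assms(1) graph_axioms assms(2)
proof (rule complete_graph_if_twin_deletions)
  fix Y :: "('a, 'b) pre_digraph" and x
  assume "graph Y" "nested_neighbours_equal Y" "dismantlable_vertex 0 Y x"
  then obtain y where y: "x \<rightarrow>\<^bsub>Y\<^esub> y" "closed_neighbours Y x = closed_neighbours Y y"
    using graph.dismantlable_vertex_0_twin[of Y x] by blast
  then show "\<exists>y. x \<rightarrow>\<^bsub>Y\<^esub> y \<and> closed_neighbours Y x = closed_neighbours Y y" by blast
  show "nested_neighbours_equal (pre_digraph.del_vert Y x)"
    using graph.nested_neighbours_equal_del_vert[OF \<open>graph Y\<close> \<open>nested_neighbours_equal Y\<close> y] .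
qed

section \<open>Graphs with complete neighbourhoods\<close>

text \<open>
  The invariant says that adjacent vertices are twins, that is, that the components are complete.
  Each deleted vertex is required to have a neighbour in the current graph, so it is a twin.
\<close>
lemma (in graph) complete_graph_if_neighbour_graphs_complete:
  assumes "reducible_by P G"
    and nonempty: "\<And>Y x. P Y x \<Longrightarrow> neighbours Y x \<noteq> {}"
    and complete: "\<And>x. x \<in> verts G \<Longrightarrow> complete_graph (neighbour_graph G x)"
  shows "complete_graph G"
proof -
  define I :: "('a, 'b) pre_digraph \<Rightarrow> bool"
    where "I = (\<lambda>Y. \<forall>x y. x \<rightarrow>\<^bsub>Y\<^esub> y \<longrightarrow> closed_neighbours Y x = closed_neighbours Y y)"
  have sub: "closed_neighbours G x \<subseteq> closed_neighbours G y" if "x \<rightarrow>\<^bsub>G\<^esub> y" for x y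
  proof -
    have "complete_graph (neighbour_graph G x)"
      using complete that by (auto dest: adj_in_verts)
    then show ?thesis
      using dominates_sym[OF that] that
      unfolding complete_graph_neighbour_graph_iff subset_iff in_closed_neighbours_iff by blast
  qed
  then have "I G" unfolding I_def by (meson dominates_sym subset_antisym)
  with assms(1) graph_axioms show ?thesis
  proof (rule complete_graph_if_twin_deletions)
    fix Y :: "('a, 'b) pre_digraph" and x
    assume Y: "graph Y" "I Y" "P Y x"
    then interpret Y: graph Y by simp
    show "\<exists>y. x \<rightarrow>\<^bsub>Y\<^esub> y \<and> closed_neighbours Y x = closed_neighbours Y y"
      using nonempty[OF Y(3)] Y(2) by (auto simp: Y.in_neighbours_iff I_def)
    show "I (pre_digraph.del_vert Y x)"
      unfolding I_def
    proof (intro allI impI)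
      fix a b assume "a \<rightarrow>\<^bsub>Y.del_vert x\<^esub> b"
      then have "a \<noteq> x" "b \<noteq> x" "a \<rightarrow>\<^bsub>Y\<^esub> b"
        by (auto simp: Y.del_vert_eq_induce_subgraph dominates_induce_subgraph_iff)
      then show "closed_neighbours (Y.del_vert x) a = closed_neighbours (Y.del_vert x) b"
        using Y(2) by (auto simp: I_def Y.closed_neighbours_del_vert)
    qed
  qed
qed

lemma (in graph) neighbour_graphs_complete_if_one_is:
  assumes "complete_transitive i G" "1 \<le> i"
    and x: "x \<in> verts G" "complete_graph (neighbour_graph G x)" and z: "z \<in> verts G"
  shows "complete_graph (neighbour_graph G z)"
proof -
  obtain f where f: "automorphism G f" "f x = z" using vertex_transitive[OF assms(1,2) x(1) z] .
  show ?thesis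
    unfolding complete_graph_neighbour_graph_iff
  proof (intro allI impI, elim conjE)
    fix a b assume ab: "z \<rightarrow>\<^bsub>G\<^esub> a" "z \<rightarrow>\<^bsub>G\<^esub> b" "a \<noteq> b"
    have "a \<in> f ` neighbours G x" "b \<in> f ` neighbours G x"
      using ab(1,2) by (simp_all add: automorphism_neighbours[OF f(1) x(1)] f(2) in_neighbours_iff)
    then obtain a' b' where "x \<rightarrow>\<^bsub>G\<^esub> a'" "x \<rightarrow>\<^bsub>G\<^esub> b'" and *: "a = f a'" "b = f b'"
      by (auto simp: in_neighbours_iff)
    then have "a' \<rightarrow>\<^bsub>G\<^esub> b'"
      using x(2) ab(3) unfolding complete_graph_neighbour_graph_iff by blast
    then show "a \<rightarrow>\<^bsub>G\<^esub> b"
      unfolding * using automorphism_neighbours[OF f(1), of a'] in_neighbours_iff adj_in_verts(1)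
      by blast
  qed
qed

section \<open>The induction\<close>

lemma dismantlable_vertex_neighbours_nonempty:
  "dismantlable_vertex k X x \<Longrightarrow> neighbours X x \<noteq> {}"
  by (cases k) auto

theorem proposition33:
  fixes X :: "('a,'b) pre_digraph" and k :: nat
  assumes "graph X" and "verts X \<noteq> {}"
    and "dismantlable k X"
    and "complete_transitive (k + 1) X"
  shows "complete_graph X"
  using assms(1,3,4)
proof (induction k arbitrary: X)
  case 0
  then interpret graph X by simp
  show ?case
    using 0 complete_graph_if_dismantlable_0 nested_neighbours_equal_if_vertex_transitive
    by (auto simp: dismantlable_def)
next
  case (Suc k)
  then interpret graph X by simp
  have red: "reducible_by (dismantlable_vertex (Suc k)) X"
    using Suc.prems by (simp add: dismantlable_def)
  then show ?case
  proof cases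
    case single
    then show ?thesis by (auto simp: complete_graph_iff card_1_singleton_iff)
  next
    case (delete x)
    have "dismantlable k (neighbour_graph X x)"
      using delete by (simp add: dismantlable_def)
    moreover have "complete_transitive (k + 1) (neighbour_graph X x)"
      using complete_transitive_neighbour_graph delete(1) Suc.prems(3) by simp
    ultimately have "complete_graph (neighbour_graph X x)"
      using Suc.IH graph_neighbour_graph by blast
    then have complete: "complete_graph (neighbour_graph X z)" if "z \<in> verts X" for z
      using neighbour_graphs_complete_if_one_is[OF Suc.prems(3) _ delete(1) _ that] by simp
    show ?thesis
      using red dismantlable_vertex_neighbours_nonempty complete
      by (rule complete_graph_if_neighbour_graphs_complete)
  qed
qed

end
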